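(* There is an absolute constant $c>0$ and tree-form strategy sets $\Pi\subset\mathbb R^d$ of arbitrarily large dimension $d$ with the following property. For every $\varepsilon>0$ and every horizon $T\le\exp\big(c\cdot\min\{d^{1/14},\varepsilon^{-1/6}\}\big)$, there exists an oblivious adversary, i.e., a probability distribution over sequences of linear utility vectors $u^{(1)},\dots,u^{(T)}\in\mathbb R^d$ (drawn independently of the learner's play, and with $|\langle u^{(t)},x\rangle|\le1$ for all $x\in\Pi$), such that every learner (even computationally unbounded), which at each round $t$ chooses $\mu^{(t)}\in\Delta(\Pi)$ based on $u^{(1)},\dots,u^{(t-1)}$, has expected swap regret $$\mathbb E\Big[\max_{\phi:\Pi\to\Pi}\frac1T\sum_{t=1}^T\mathbb E_{x\sim\mu^{(t)}}\langle u^{(t)},\phi(x)-x\rangle\Big]\ge\varepsilon .$$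
   Context: A tree-form decision problem is a rooted tree whose internal nodes are decision points (where the player picks an outgoing edge/action) and observation points (where the environment picks an outgoing edge); leaves are terminal nodes, and $d$ is the number of terminal nodes. A pure strategy picks one action at every decision point; its tree-form (realization-form) representation is $x\in\{0,1\}^d$ with $x[z]=1$ iff all player actions on the root-to-$z$ path are chosen by the strategy. The tree-form strategy set $\Pi\subset\{0,1\}^d$ is the set of these vectors (or a linear image thereof). Utilities are linear: the utility of $x$ at round $t$ is $\langle u^{(t)},x\rangle$. $\Delta(\Pi)$ denotes distributions over $\Pi$.
   Formalization: The claim is proved for 0 < ε ≤ c rather than every ε > 0: for ε > 2 it fails at T = 1, since swap regret never exceeds 2; with the constant used, c = 1/16, the excluded ε > c allow only the horizon T = 1. *)

theory Defs
  imports "HOL-Probability.Probability"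
begin

text \<open>A node is a terminal node, a decision point (player picks a child = action),
  or an observation point (environment picks a child).\<close>
datatype tdp = Terminal | Decision "tdp list" | Observation "tdp list"

fun wf_tdp :: "tdp \<Rightarrow> bool" where
  "wf_tdp Terminal = True"
| "wf_tdp (Decision ts) = (ts \<noteq> [] \<and> (\<forall>s\<in>set ts. wf_tdp s))"
| "wf_tdp (Observation ts) = (ts \<noteq> [] \<and> (\<forall>s\<in>set ts. wf_tdp s))"

lemma size_nth_less: "i < length ts \<Longrightarrow> size (ts ! i) < Suc (size_list size ts)"
  by (metis less_Suc_eq_le nth_mem size_list_estimation' order_refl)

function subtree :: "tdp \<Rightarrow> nat list \<Rightarrow> tdp option" where
  "subtree t [] = Some t"
| "subtree Terminal (i # p) = None"
| "subtree (Decision ts) (i # p) = (if i < length ts then subtree (ts ! i) p else None)"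
| "subtree (Observation ts) (i # p) = (if i < length ts then subtree (ts ! i) p else None)"
  by pat_completeness auto
termination by (relation "Wellfounded.measure (size \<circ> fst)") (auto simp: size_nth_less)

function terminals :: "tdp \<Rightarrow> nat list list" where
  "terminals Terminal = [[]]"
| "terminals (Decision ts) =
     concat (map (\<lambda>i. map (Cons i) (terminals (ts ! i))) [0..<length ts])"
| "terminals (Observation ts) =
     concat (map (\<lambda>i. map (Cons i) (terminals (ts ! i))) [0..<length ts])"
  by pat_completeness auto
termination by (relation "Wellfounded.measure size") (auto simp: size_nth_less)

definition dim :: "tdp \<Rightarrow> nat" where
  "dim t = length (terminals t)"

definition is_decision_point :: "tdp \<Rightarrow> nat list \<Rightarrow> bool" where
  "is_decision_point t p \<longleftrightarrow> (\<exists>ts. subtree t p = Some (Decision ts))"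

definition pure_strategy :: "tdp \<Rightarrow> (nat list \<Rightarrow> nat) \<Rightarrow> bool" where
  "pure_strategy t \<sigma> \<longleftrightarrow>
     (\<forall>p ts. subtree t p = Some (Decision ts) \<longrightarrow> \<sigma> p < length ts)"

definition realization :: "tdp \<Rightarrow> (nat list \<Rightarrow> nat) \<Rightarrow> (nat \<Rightarrow> real)" where
  "realization t \<sigma> = (\<lambda>i. if i < dim t \<and>
       (let z = terminals t ! i in
          \<forall>k < length z. is_decision_point t (take k z) \<longrightarrow> \<sigma> (take k z) = z ! k)
     then 1 else 0)"

definition strategy_set :: "tdp \<Rightarrow> (nat \<Rightarrow> real) set" where
  "strategy_set t = {realization t \<sigma> | \<sigma>. pure_strategy t \<sigma>}"

definition inner_d :: "nat \<Rightarrow> (nat \<Rightarrow> real) \<Rightarrow> (nat \<Rightarrow> real) \<Rightarrow> real" where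
  "inner_d d u x = (\<Sum>i<d. u i * x i)"

text \<open>Utility sequences are indexed by rounds \<open>0..T-1\<close> (round t+1 in the paper).
  An oblivious adversary is a probability distribution over such sequences whose
  support satisfies the boundedness condition.\<close>
definition adversary :: "tdp \<Rightarrow> nat \<Rightarrow> (nat \<Rightarrow> nat \<Rightarrow> real) pmf \<Rightarrow> bool" where
  "adversary t T A \<longleftrightarrow>
     (\<forall>u\<in>set_pmf A. \<forall>s<T. \<forall>x\<in>strategy_set t. \<bar>inner_d (dim t) (u s) x\<bar> \<le> 1)"

definition learner ::
  "tdp \<Rightarrow> (nat \<Rightarrow> (nat \<Rightarrow> nat \<Rightarrow> real) \<Rightarrow> (nat \<Rightarrow> real) pmf) \<Rightarrow> bool" where
  "learner t L \<longleftrightarrow>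
     (\<forall>s u. set_pmf (L s u) \<subseteq> strategy_set t) \<and>
     (\<forall>s u u'. (\<forall>r<s. u r = u' r) \<longrightarrow> L s u = L s u')"

definition swap_regret ::
  "tdp \<Rightarrow> nat \<Rightarrow> (nat \<Rightarrow> (nat \<Rightarrow> nat \<Rightarrow> real) \<Rightarrow> (nat \<Rightarrow> real) pmf)
     \<Rightarrow> (nat \<Rightarrow> nat \<Rightarrow> real) \<Rightarrow> real" where
  "swap_regret t T L u =
     (\<Squnion>\<phi> \<in> (strategy_set t \<rightarrow> strategy_set t).
        (1 / real T) * (\<Sum>s<T. measure_pmf.expectation (L s u)
           (\<lambda>x. inner_d (dim t) (u s) (\<phi> x) - inner_d (dim t) (u s) x)))"

definition expected_swap_regret ::
  "tdp \<Rightarrow> nat \<Rightarrow> (nat \<Rightarrow> nat \<Rightarrow> real) pmf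
     \<Rightarrow> (nat \<Rightarrow> (nat \<Rightarrow> nat \<Rightarrow> real) \<Rightarrow> (nat \<Rightarrow> real) pmf) \<Rightarrow> real" where
  "expected_swap_regret t T A L = measure_pmf.expectation A (\<lambda>u. swap_regret t T L u)"

end

theory Submission
  imports Defs
begin

text \<open>
  Identify the rounds \<open>t < T \<le> 2^D\<close> with leaves of a binary tree of depth \<open>D\<close>; the ancestor of \<open>t\<close>
  at height \<open>i\<close> is \<open>t div 2^i\<close>. In the game an observation point chooses one of many decision points
  with \<open>K\<close> actions each, so that a strategy is a word over an alphabet of size \<open>K\<close>. Every tree node
  draws a uniformly random word of length \<open>m\<close>, and left and right children of height \<open>i\<close> use two
  separate blocks of decision points. The utility in round \<open>t\<close> is the average, over the heights
  \<open>i < D\<close>, of the fraction of letters on which the strategy agrees with the word of the ancestor of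
  height \<open>i\<close>.

  Suppose that the learner first plays \<open>x\<close> seriously in round \<open>\<tau>\<close>. The swap moves \<open>x\<close> to the strategy
  that agrees with the words of all ancestors of \<open>\<tau>\<close> and of their siblings. In a round \<open>t \<ge> \<tau>\<close> let
  \<open>j\<close> be the height at which the path of \<open>t\<close> joins that of \<open>\<tau>\<close> up to siblings. From height \<open>j\<close> on
  the target agrees perfectly. At heights up to \<open>j\<close> the words of the ancestors of \<open>t\<close> were not yet
  revealed when \<open>x\<close> was chosen, so \<open>x\<close> agrees with them on few letters only. At height \<open>j\<close> both
  happen, so the swap gains almost \<open>1 / D\<close> in every round \<open>t \<ge> \<tau>\<close>.

  The learner may put tiny weights on all strategies in advance; therefore \<open>\<tau>\<close> is the first round in
  which the weight of \<open>x\<close> is at least a \<open>\<delta>\<close> fraction of its maximal weight. Earlier rounds carry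
  negligible weight, and the factor \<open>1 / \<delta>\<close> lost in the union bound over \<open>t\<close>, \<open>\<tau>\<close>, \<open>i\<close> is paid for by
  the exponentially small probability that a word agrees with a previously fixed \<open>x\<close> on more than a
  \<open>\<gamma>\<close> fraction of its letters.
\<close>

section \<open>A depth-two game\<close>

definition grid_game :: "nat \<Rightarrow> nat \<Rightarrow> tdp" where
  "grid_game M K = Observation (replicate M (Decision (replicate K Terminal)))"

text \<open>The terminals are listed row by row: coordinate \<open>k\<close> is the terminal behind
  decision point \<open>k div K\<close> and action \<open>k mod K\<close>.\<close>

definition grid_strategy :: "nat \<Rightarrow> nat \<Rightarrow> (nat \<Rightarrow> nat) \<Rightarrow> nat \<Rightarrow> real" where
  "grid_strategy M K f k = of_bool (k < M * K \<and> f (k div K) = k mod K)"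

lemma wf_grid_game: "0 < M \<Longrightarrow> 0 < K \<Longrightarrow> wf_tdp (grid_game M K)"
  by (auto simp: grid_game_def)

lemma terminals_decision_replicate:
  "terminals (Decision (replicate K Terminal)) = map (\<lambda>a. [a]) [0..<K]"
proof -
  have "concat (map (\<lambda>i. map (Cons i) (terminals (replicate K Terminal ! i))) [0..<K])
      = concat (map (\<lambda>i. [[i]]) [0..<K])"
    by (intro arg_cong[where f = concat] map_cong) auto
  then show ?thesis by simp
qed

lemma concat_blocks_upt:
  "concat (map (\<lambda>p. map (\<lambda>a. [p, a]) [0..<K]) [0..<M]) = map (\<lambda>k. [k div K, k mod K]) [0..<M * K]"
proof (induction M)
  case (Suc M)
  have "[0..<M * K + K] = [0..<M * K] @ [M * K..<M * K + K]"
    by (rule upt_add_eq_append) simp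
  then have "[0..<Suc M * K] = [0..<M * K] @ map (\<lambda>a. a + M * K) [0..<K]"
    by (simp add: map_add_upt add.commute)
  moreover have "map (\<lambda>k. [k div K, k mod K]) (map (\<lambda>a. a + M * K) [0..<K])
      = map (\<lambda>a. [M, a]) [0..<K]"
    by auto
  ultimately show ?case using Suc by simp
qed simp

lemma terminals_grid_game:
  "terminals (grid_game M K) = map (\<lambda>k. [k div K, k mod K]) [0..<M * K]"
proof -
  have "terminals (grid_game M K) = concat (map (\<lambda>p. map (\<lambda>a. [p, a]) [0..<K]) [0..<M])"
    unfolding grid_game_def terminals.simps
    by (intro arg_cong[where f = concat] map_cong)
       (auto simp: terminals_decision_replicate simp del: terminals.simps)
  then show ?thesis by (simp add: concat_blocks_upt)
qed

lemma dim_grid_game: "dim (grid_game M K) = M * K"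
  by (simp add: dim_def terminals_grid_game)

lemma subtree_grid_game_Cons:
  "subtree (grid_game M K) (p # ps) =
     (if p < M then subtree (Decision (replicate K Terminal)) ps else None)"
  by (simp add: grid_game_def)

lemma subtree_grid_game_eq_Decision:
  "subtree (grid_game M K) ps = Some (Decision ts) \<longleftrightarrow>
     (\<exists>p<M. ps = [p] \<and> ts = replicate K Terminal)"
proof (cases ps)
  case Nil
  then show ?thesis by (simp add: grid_game_def)
next
  case (Cons p qs)
  have "subtree (Decision (replicate K Terminal)) (a # qs') \<noteq> Some (Decision ts)" for a qs'
    by (cases qs') auto
  then show ?thesis using Cons
    by (cases qs) (auto simp: subtree_grid_game_Cons simp del: subtree.simps(3))
qed

lemma realization_grid_game:
  "realization (grid_game M K) \<sigma> = grid_strategy M K (\<lambda>p. \<sigma> [p])"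
proof
  fix k
  show "realization (grid_game M K) \<sigma> k = grid_strategy M K (\<lambda>p. \<sigma> [p]) k"
  proof (cases "k < M * K")
    case True
    then have "k div K < M"
      by (simp add: less_mult_imp_div_less)
    moreover have "terminals (grid_game M K) ! k = [k div K, k mod K]"
      using True by (simp add: terminals_grid_game)
    ultimately show ?thesis using True
      by (simp add: realization_def grid_strategy_def dim_grid_game is_decision_point_def
          subtree_grid_game_eq_Decision Let_def All_less_Suc numeral_2_eq_2)
  qed (simp add: realization_def grid_strategy_def dim_grid_game)
qed

lemma strategy_set_grid_game:
  "strategy_set (grid_game M K) = {grid_strategy M K f | f. \<forall>p<M. f p < K}"
proof -
  have "pure_strategy (grid_game M K) \<sigma> \<longleftrightarrow> (\<forall>p<M. \<sigma> [p] < K)" for \<sigma>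
    unfolding pure_strategy_def subtree_grid_game_eq_Decision by fastforce
  moreover have "\<exists>\<sigma>. grid_strategy M K f = grid_strategy M K (\<lambda>p. \<sigma> [p]) \<and> (\<forall>p<M. \<sigma> [p] < K)"
    if "\<forall>p<M. f p < K" for f
    using that by (intro exI[of _ "\<lambda>ps. f (hd ps)"]) simp
  ultimately show ?thesis
    unfolding strategy_set_def realization_grid_game by blast
qed

text \<open>The words \<open>f\<close> are arbitrary beyond \<open>M\<close>, so finiteness is read
  off from the 0/1 vectors instead. It turns expectations over strategies into finite sums.\<close>

lemma finite_strategy_set_grid_game: "finite (strategy_set (grid_game M K))"
proof -
  have "strategy_set (grid_game M K) \<subseteq>
      (\<lambda>A k. of_bool (k \<in> A)) ` Pow {..<M * K}"
  proof
    fix x assume "x \<in> strategy_set (grid_game M K)"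
    then obtain f where "x = grid_strategy M K f"
      by (auto simp: strategy_set_grid_game)
    then have "x = (\<lambda>k. of_bool (k \<in> {k. k < M * K \<and> f (k div K) = k mod K}))"
      by (auto simp: grid_strategy_def)
    then show "x \<in> (\<lambda>A k. of_bool (k \<in> A)) ` Pow {..<M * K}"
      by blast
  qed
  then show ?thesis by (rule finite_subset) simp
qed

lemma grid_index_less:
  assumes "p < M" "a < (K::nat)"
  shows "p * K + a < M * K"
proof -
  have "p * K + a < Suc p * K" using assms by simp
  also have "\<dots> \<le> M * K" using assms by (intro mult_le_mono1) simp
  finally show ?thesis .
qed

lemma grid_strategy_index:
  "p < M \<Longrightarrow> a < K \<Longrightarrow> grid_strategy M K f (p * K + a) = of_bool (f p = a)"
  using grid_index_less[of p M a K] by (simp add: grid_strategy_def)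

section \<open>Finitely supported product measures\<close>

lemma expectation_pair_pmf_finite:
  fixes F :: "'a \<times> 'b \<Rightarrow> real"
  assumes "finite (set_pmf P)" "finite (set_pmf Q)"
  shows "measure_pmf.expectation (pair_pmf P Q) F =
    measure_pmf.expectation P (\<lambda>a. measure_pmf.expectation Q (\<lambda>b. F (a, b)))"
proof -
  have "measure_pmf.expectation (pair_pmf P Q) F =
      (\<Sum>ab\<in>set_pmf P \<times> set_pmf Q. F ab * pmf (pair_pmf P Q) ab)"
    using assms by (intro integral_measure_pmf_real) auto
  also have "\<dots> = (\<Sum>a\<in>set_pmf P. \<Sum>b\<in>set_pmf Q. F (a, b) * (pmf P a * pmf Q b))"
    by (auto simp: sum.cartesian_product pmf_pair intro: sum.cong)
  also have "\<dots> = (\<Sum>a\<in>set_pmf P. (\<Sum>b\<in>set_pmf Q. F (a, b) * pmf Q b) * pmf P a)"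
    by (simp add: sum_distrib_left mult_ac)
  also have "\<dots> = (\<Sum>a\<in>set_pmf P. measure_pmf.expectation Q (\<lambda>b. F (a, b)) * pmf P a)"
    using assms by (intro sum.cong refl arg_cong2[where f = "(*)"] integral_measure_pmf_real[symmetric]) auto
  also have "\<dots> = measure_pmf.expectation P (\<lambda>a. measure_pmf.expectation Q (\<lambda>b. F (a, b)))"
    using assms by (intro integral_measure_pmf_real[symmetric]) auto
  finally show ?thesis .
qed

lemma finite_set_Pi_pmf:
  assumes "finite I" "\<And>i. i \<in> I \<Longrightarrow> finite (set_pmf (p i))"
  shows "finite (set_pmf (Pi_pmf I d p))"
  using assms by (simp add: set_Pi_pmf finite_PiE_dflt)

lemma expectation_le_const:
  fixes F :: "'a \<Rightarrow> real"
  assumes "finite (set_pmf P)" "\<And>a. a \<in> set_pmf P \<Longrightarrow> F a \<le> c"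
  shows "measure_pmf.expectation P F \<le> c"
  using assms by (intro measure_pmf.integral_le_const integrable_measure_pmf_finite AE_pmfI)

text \<open>By independence it suffices to bound the mean over the coordinates in \<open>B\<close>
  for each fixed choice of the others. Later \<open>B\<close> carries the letters of one unrevealed
  word.\<close>

lemma expectation_Pi_pmf_le_fiberwise:
  fixes F :: "('a \<Rightarrow> 'b) \<Rightarrow> real"
  assumes I: "finite I" "B \<subseteq> I" and fin: "\<And>i. i \<in> I \<Longrightarrow> finite (set_pmf (p i))"
    and le: "\<And>f. f \<in> set_pmf (Pi_pmf (I - B) d p) \<Longrightarrow>
      measure_pmf.expectation (Pi_pmf B d p) (\<lambda>g. F (\<lambda>i. if i \<in> B then g i else f i)) \<le> c"
  shows "measure_pmf.expectation (Pi_pmf I d p) F \<le> c"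
proof -
  have fB: "finite B" using I finite_subset by blast
  have fin_sets: "finite (set_pmf (Pi_pmf B d p))" "finite (set_pmf (Pi_pmf (I - B) d p))"
    using I fin fB by (auto intro!: finite_set_Pi_pmf)
  have "Pi_pmf I d p = Pi_pmf ((I - B) \<union> B) d p"
    using I by (simp add: Un_absorb2)
  also have "\<dots> = map_pmf (\<lambda>(f, g) i. if i \<in> I - B then f i else g i)
      (pair_pmf (Pi_pmf (I - B) d p) (Pi_pmf B d p))"
    using I fB by (intro Pi_pmf_union) auto
  also have "\<dots> = map_pmf (\<lambda>(f, g) i. if i \<in> B then g i else f i)
      (pair_pmf (Pi_pmf (I - B) d p) (Pi_pmf B d p))"
  \<comment> \<open>Off \<open>I\<close> both samples take the default value \<open>d\<close>, so
    either case distinction gives the same function.\<close>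
  proof (intro map_pmf_cong refl, clarify, rule ext)
    fix f g i assume *: "(f, g) \<in> set_pmf (pair_pmf (Pi_pmf (I - B) d p) (Pi_pmf B d p))"
    have "f i = d" "g i = d" if "i \<notin> I"
      using * that I fB set_Pi_pmf_subset[of "I - B" d p] set_Pi_pmf_subset[of B d p] by auto
    then show "(if i \<in> I - B then f i else g i) = (if i \<in> B then g i else f i)"
      using I by auto
  qed
  finally have split: "Pi_pmf I d p = map_pmf (\<lambda>(f, g) i. if i \<in> B then g i else f i)
      (pair_pmf (Pi_pmf (I - B) d p) (Pi_pmf B d p))" .
  have "measure_pmf.expectation (Pi_pmf I d p) F =
      measure_pmf.expectation (Pi_pmf (I - B) d p) (\<lambda>f.
        measure_pmf.expectation (Pi_pmf B d p) (\<lambda>g. F (\<lambda>i. if i \<in> B then g i else f i)))"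
    unfolding split integral_map_pmf
    using fin_sets by (subst expectation_pair_pmf_finite) auto
  also have "\<dots> \<le> c"
    by (rule expectation_le_const[OF fin_sets(2) le])
  finally show ?thesis .
qed

section \<open>The random utilities\<close>

locale swap_adversary =
  fixes n D T m K :: nat
  assumes D_pos: "0 < D" and D_le: "D \<le> n" and T_pos: "0 < T" and T_le: "T \<le> 2 ^ D"
    and m_pos: "0 < m" and K_pos: "0 < K"
begin

abbreviation "M \<equiv> 2 * n * m"
abbreviation "G \<equiv> grid_game M K"

text \<open>Letter \<open>r\<close> of the word that round \<open>t\<close> uses at height \<open>i\<close> is compared with the action at
  decision point \<open>pos t i r\<close>; the parity of \<open>t div 2 ^ i\<close> selects the block of a left or right child.\<close>

definition pos :: "nat \<Rightarrow> nat \<Rightarrow> nat \<Rightarrow> nat" where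
  "pos t i r = (2 * i + (t div 2 ^ i) mod 2) * m + r"

definition slot :: "(nat \<times> nat \<times> nat \<Rightarrow> nat) \<Rightarrow> nat \<Rightarrow> nat \<Rightarrow> nat \<Rightarrow> nat" where
  "slot \<omega> t i r = pos t i r * K + \<omega> (i, t div 2 ^ i, r)"

definition util :: "(nat \<times> nat \<times> nat \<Rightarrow> nat) \<Rightarrow> nat \<Rightarrow> nat \<Rightarrow> real" where
  "util \<omega> t k = (\<Sum>i<D. \<Sum>r<m. of_bool (k = slot \<omega> t i r)) / (real D * real m)"

definition agreement :: "(nat \<times> nat \<times> nat \<Rightarrow> nat) \<Rightarrow> nat \<Rightarrow> nat \<Rightarrow> (nat \<Rightarrow> real) \<Rightarrow> real" where
  "agreement \<omega> t i x = (\<Sum>r<m. x (slot \<omega> t i r)) / real m"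

definition indices :: "(nat \<times> nat \<times> nat) set" where
  "indices = {..<D} \<times> {..<2 ^ D} \<times> {..<m}"

definition noise :: "(nat \<times> nat \<times> nat \<Rightarrow> nat) pmf" where
  "noise = Pi_pmf indices 0 (\<lambda>_. pmf_of_set {..<K})"

text \<open>Block \<open>l\<close> serves the children of parity \<open>l mod 2\<close> at height
  \<open>l div 2\<close>. Reading the child of that parity of the parent
  \<open>\<tau> div 2 ^ Suc i\<close> encodes an ancestor of \<open>\<tau>\<close> and its sibling
  at once.\<close>

definition target :: "(nat \<times> nat \<times> nat \<Rightarrow> nat) \<Rightarrow> nat \<Rightarrow> nat \<Rightarrow> real" where
  "target \<omega> \<tau> = grid_strategy M K (\<lambda>p. let l = p div m; i = l div 2 in
     \<omega> (i, 2 * (\<tau> div 2 ^ Suc i) + l mod 2, p mod m))"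

text \<open>These are the heights at which the word of round \<open>t\<close> has not occurred
  before round \<open>\<tau>\<close> and so cannot influence the learner's choice there.\<close>

definition fresh :: "nat \<Rightarrow> nat \<Rightarrow> nat set" where
  "fresh \<tau> t = {i. i < D \<and> (\<forall>s<\<tau>. s div 2 ^ i \<noteq> t div 2 ^ i)}"

section \<open>Utilities as averaged agreements\<close>

lemma finite_indices: "finite indices"
  by (simp add: indices_def)

lemma set_pmf_of_set_K: "set_pmf (pmf_of_set {..<K}) = {..<K}"
  using K_pos by (intro set_pmf_of_set) auto

lemma finite_noise: "finite (set_pmf noise)"
  unfolding noise_def using finite_indices set_pmf_of_set_K by (intro finite_set_Pi_pmf) auto

lemma Pi_pmf_K_less:
  assumes "finite B" "\<omega> \<in> set_pmf (Pi_pmf B 0 (\<lambda>_. pmf_of_set {..<K}))"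
  shows "\<omega> z < K"
  using assms K_pos by (cases "z \<in> B") (auto simp: set_Pi_pmf PiE_dflt_def set_pmf_of_set_K)

text \<open>Off \<open>indices\<close> the default letter 0 is a legal action too, so
  \<open>target\<close> is a strategy even though it also reads letters at heights from
  \<open>D\<close> on.\<close>

lemma noise_less: "\<omega> \<in> set_pmf noise \<Longrightarrow> \<omega> z < K"
  unfolding noise_def using finite_indices by (rule Pi_pmf_K_less)

lemma pos_less:
  assumes "i < D" "r < m"
  shows "pos t i r < M"
proof -
  have "2 * i + (t div 2 ^ i) mod 2 < 2 * n"
    using assms D_le by (simp add: mod_2_eq_odd)
  then show ?thesis unfolding pos_def using assms(2) by (rule grid_index_less)
qed

lemma strategy_in_01: "x \<in> strategy_set G \<Longrightarrow> x k = 0 \<or> x k = 1"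
  by (auto simp: strategy_set_grid_game grid_strategy_def)

lemma strategy_ge_0: "x \<in> strategy_set G \<Longrightarrow> 0 \<le> x k"
  and strategy_le_1: "x \<in> strategy_set G \<Longrightarrow> x k \<le> 1"
  using strategy_in_01[of x k] by auto

lemma target_in: "(\<And>z. \<omega> z < K) \<Longrightarrow> target \<omega> \<tau> \<in> strategy_set G"
  by (auto simp: target_def strategy_set_grid_game Let_def)

lemma agreement_bounds:
  assumes "x \<in> strategy_set G"
  shows "0 \<le> agreement \<omega> t i x" "agreement \<omega> t i x \<le> 1"
proof -
  have "0 \<le> (\<Sum>r<m. x (slot \<omega> t i r))"
    using assms by (intro sum_nonneg strategy_ge_0)
  then show "0 \<le> agreement \<omega> t i x"
    by (simp add: agreement_def)
  have "(\<Sum>r<m. x (slot \<omega> t i r)) \<le> (\<Sum>r<m. 1)"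
    using assms by (intro sum_mono strategy_le_1)
  then show "agreement \<omega> t i x \<le> 1"
    using m_pos by (simp add: agreement_def)
qed

lemma inner_util:
  assumes "\<And>z. \<omega> z < K"
  shows "inner_d (dim G) (util \<omega> t) x = (\<Sum>i<D. agreement \<omega> t i x) / real D"
proof -
  have sl: "slot \<omega> t i r < M * K" if "i < D" "r < m" for i r
    unfolding slot_def using that assms by (intro grid_index_less pos_less)
  have "inner_d (dim G) (util \<omega> t) x =
      (\<Sum>k<M * K. (\<Sum>i<D. \<Sum>r<m. of_bool (k = slot \<omega> t i r)) * x k) / (real D * real m)"
    unfolding inner_d_def dim_grid_game util_def times_divide_eq_left
    by (rule sum_divide_distrib[symmetric])
  also have "(\<Sum>k<M * K. (\<Sum>i<D. \<Sum>r<m. of_bool (k = slot \<omega> t i r)) * x k) =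
      (\<Sum>k<M * K. \<Sum>i<D. \<Sum>r<m. of_bool (k = slot \<omega> t i r) * x k)"
    unfolding sum_distrib_right ..
  also have "(\<Sum>k<M * K. \<Sum>i<D. \<Sum>r<m. of_bool (k = slot \<omega> t i r) * x k) =
      (\<Sum>i<D. \<Sum>r<m. \<Sum>k<M * K. of_bool (k = slot \<omega> t i r) * x k)"
    by (rule trans[OF sum.swap], rule sum.cong[OF refl], rule sum.swap)
  also have "\<dots> = (\<Sum>i<D. \<Sum>r<m. x (slot \<omega> t i r))"
  proof (intro sum.cong refl)
    fix i r assume "i \<in> {..<D}" "r \<in> {..<m}"
    then have "slot \<omega> t i r \<in> {..<M * K}" using sl by auto
    moreover have "(\<Sum>k<M * K. of_bool (k = slot \<omega> t i r) * x k) =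
        (\<Sum>k<M * K. if k = slot \<omega> t i r then x k else 0)"
      by (intro sum.cong) auto
    ultimately show "(\<Sum>k<M * K. of_bool (k = slot \<omega> t i r) * x k) = x (slot \<omega> t i r)"
      by simp
  qed
  finally show ?thesis
    by (simp add: agreement_def sum_divide_distrib[symmetric] divide_divide_eq_left mult.commute)
qed

lemma inner_util_bounds:
  assumes "\<And>z. \<omega> z < K" "x \<in> strategy_set G"
  shows "0 \<le> inner_d (dim G) (util \<omega> t) x" "inner_d (dim G) (util \<omega> t) x \<le> 1"
proof -
  show "0 \<le> inner_d (dim G) (util \<omega> t) x"
    using assms by (auto simp: inner_util intro!: divide_nonneg_nonneg sum_nonneg agreement_bounds)
  have "(\<Sum>i<D. agreement \<omega> t i x) \<le> (\<Sum>i<D. 1)"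
    using assms by (intro sum_mono agreement_bounds)
  then show "inner_d (dim G) (util \<omega> t) x \<le> 1"
    using assms D_pos by (simp add: inner_util)
qed

section \<open>Gain of the swap and chance agreement\<close>

lemma agreement_target:
  assumes \<omega>: "\<And>z. \<omega> z < K" and "i < D" and same: "t div 2 ^ Suc i = \<tau> div 2 ^ Suc i"
  shows "agreement \<omega> t i (target \<omega> \<tau>) = 1"
proof -
  \<comment> \<open>With equal parents, the node of \<open>t\<close> is the ancestor of
    \<open>\<tau>\<close> or its sibling, and its parity recovers its number.\<close>
  have "\<tau> div 2 ^ Suc i = t div 2 ^ i div 2"
    using same by (simp add: div_mult2_eq[symmetric] mult.commute)
  then have "2 * (\<tau> div 2 ^ Suc i) + (t div 2 ^ i) mod 2 = t div 2 ^ i"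
    by (simp only: mult_div_mod_eq)
  moreover have "pos t i r div m = 2 * i + (t div 2 ^ i) mod 2" "pos t i r mod m = r" if "r < m" for r
    using that by (simp_all add: pos_def)
  moreover have "(2 * i + (t div 2 ^ i) mod 2) div 2 = i"
      "(2 * i + (t div 2 ^ i) mod 2) mod 2 = (t div 2 ^ i) mod 2"
    by (simp_all add: div_add1_eq)
  ultimately have "target \<omega> \<tau> (slot \<omega> t i r) = 1" if "r < m" for r
    unfolding target_def slot_def using that pos_less[OF \<open>i < D\<close> that] \<omega>
    by (subst grid_strategy_index) (simp_all add: Let_def)
  then have "(\<Sum>r<m. target \<omega> \<tau> (slot \<omega> t i r)) = (\<Sum>r<m. 1)"
    by (intro sum.cong) auto
  then show ?thesis using m_pos by (simp add: agreement_def)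
qed

text \<open>From the meeting height \<open>j\<close> on the target agrees fully and loses nothing to
  \<open>x\<close>; up to \<open>j\<close> the heights are fresh, so the loss is at most the
  agreement of \<open>x\<close> there. Height \<open>j\<close> is of both kinds and yields the
  1.\<close>

lemma target_gain:
  assumes \<omega>: "\<And>z. \<omega> z < K" and "\<tau> \<le> t" "t < T" and x: "x \<in> strategy_set G"
  shows "(1 - (\<Sum>i\<in>fresh \<tau> t. agreement \<omega> t i x)) / real D \<le>
    inner_d (dim G) (util \<omega> t) (target \<omega> \<tau>) - inner_d (dim G) (util \<omega> t) x"
proof -
  let ?same = "\<lambda>j. t div 2 ^ Suc j = \<tau> div 2 ^ Suc j"
  define j where "j = (LEAST j. ?same j)"
  \<comment> \<open>Both rounds are below \<open>2 ^ D\<close>, so their nodes at height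
    \<open>D\<close> are both 0.\<close>
  have "?same (D - 1)"
    using assms(2,3) T_le D_pos by simp
  then have j: "?same j" "j \<le> D - 1"
    unfolding j_def by (auto intro: LeastI Least_le)
  have before: "\<not> ?same i" if "i < j" for i
    using that not_less_Least unfolding j_def by blast
  have after: "?same i" if "j \<le> i" for i
  proof -
    have e: "(2::nat) ^ Suc i = 2 ^ Suc j * 2 ^ (i - j)"
      using that by (simp flip: power_add)
    show ?thesis unfolding e div_mult2_eq by (simp only: j(1))
  qed
  \<comment> \<open>For \<open>i > 0\<close> the node of \<open>t\<close> differs from that of
    \<open>\<tau>\<close>, since \<open>i - 1 < j\<close>; by monotonicity it lies strictly to the
    right of all nodes visited before \<open>\<tau>\<close>.\<close>
  have fresh: "i \<in> fresh \<tau> t" if "i \<le> j" for i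
  proof -
    have "s div 2 ^ i \<noteq> t div 2 ^ i" if "s < \<tau>" for s
    proof (cases i)
      case 0
      then show ?thesis using \<open>s < \<tau>\<close> \<open>\<tau> \<le> t\<close> by simp
    next
      case (Suc i')
      then have "t div 2 ^ i \<noteq> \<tau> div 2 ^ i"
        using before[of i'] \<open>i \<le> j\<close> by simp
      moreover have "s div 2 ^ i \<le> \<tau> div 2 ^ i" "\<tau> div 2 ^ i \<le> t div 2 ^ i"
        using \<open>s < \<tau>\<close> \<open>\<tau> \<le> t\<close> by (auto intro: div_le_mono)
      ultimately show ?thesis by linarith
    qed
    then show ?thesis using that j D_pos by (auto simp: fresh_def)
  qed
  have tgt: "target \<omega> \<tau> \<in> strategy_set G" using \<omega> by (rule target_in)
  have "of_bool (i = j) - of_bool (i \<in> fresh \<tau> t) * agreement \<omega> t i x \<le>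
      agreement \<omega> t i (target \<omega> \<tau>) - agreement \<omega> t i x" if "i < D" for i
  proof (cases "j \<le> i")
    case True
    then have "agreement \<omega> t i (target \<omega> \<tau>) = 1"
      using \<omega> that after by (intro agreement_target)
    then show ?thesis
      using agreement_bounds[OF x, of \<omega> t i] fresh[of i] by (auto simp: of_bool_def)
  next
    case False
    then show ?thesis
      using agreement_bounds[OF tgt, of \<omega> t i] fresh[of i] by auto
  qed
  then have "(\<Sum>i<D. of_bool (i = j) - of_bool (i \<in> fresh \<tau> t) * agreement \<omega> t i x) \<le>
      (\<Sum>i<D. agreement \<omega> t i (target \<omega> \<tau>) - agreement \<omega> t i x)"
    by (intro sum_mono) auto
  moreover have "(\<Sum>i<D. of_bool (i = j)) = (1::real)"
    using j D_pos by (simp add: of_bool_def)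
  moreover have "(\<Sum>i<D. of_bool (i \<in> fresh \<tau> t) * agreement \<omega> t i x) =
      (\<Sum>i\<in>fresh \<tau> t. agreement \<omega> t i x)"
    by (intro sum.mono_neutral_cong_right) (auto simp: fresh_def)
  ultimately show ?thesis
    using \<omega> D_pos by (simp add: inner_util sum_subtractf divide_right_mono flip: diff_divide_distrib)
qed


text \<open>Once all other letters are fixed, so is the learner's distribution in round
  \<open>\<tau>\<close>, while the word of round \<open>t\<close> at height \<open>i\<close> is
  still uniform. An exponential moment then bounds its agreement with each \<open>x\<close>.\<close>

lemma agreement_tail:
  assumes L: "learner G L" and i: "i \<in> fresh \<tau> t" and t: "t < T"
  shows "measure_pmf.expectation noise (\<lambda>\<omega>. \<Sum>x\<in>strategy_set G.
      pmf (L \<tau> (util \<omega>)) x * of_bool (\<gamma> < agreement \<omega> t i x)) \<le>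
    (1 + 1 / real K) ^ m / 2 powr (\<gamma> * real m)"
proof -
  let ?q = "t div 2 ^ i" and ?S = "strategy_set G"
  let ?P = "\<lambda>B. Pi_pmf B 0 (\<lambda>_::nat \<times> nat \<times> nat. pmf_of_set {..<K})"
  define B where "B = (\<lambda>r. (i, ?q, r)) ` {..<m}"
  have iD: "i < D" using i by (simp add: fresh_def)
  have "?q \<le> t" by (rule div_le_dividend)
  then have "?q < 2 ^ D" using t T_le by linarith
  then have B: "B \<subseteq> indices" "finite B"
    using iD by (auto simp: B_def indices_def)
  have inj: "inj_on (\<lambda>r. (i, ?q, r)) {..<m}" by (auto simp: inj_on_def)
  show ?thesis unfolding noise_def
  proof (rule expectation_Pi_pmf_le_fiberwise[OF finite_indices B(1)])
    show "finite (set_pmf (pmf_of_set {..<K}))" by (simp add: set_pmf_of_set_K)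
  next
    fix f :: "nat \<times> nat \<times> nat \<Rightarrow> nat"
    let ?h = "\<lambda>g z. if z \<in> B then g z else f z"
    let ?w = "\<lambda>x. pmf (L \<tau> (util f)) x"
    \<comment> \<open>The earlier utilities read no letter in \<open>B\<close>, because height
      \<open>i\<close> is fresh.\<close>
    have "util (?h g) s = util f s" if "s < \<tau>" for g s
    proof -
      have "(i', s div 2 ^ i', r) \<notin> B" for i' r
        using i that by (auto simp: B_def fresh_def)
      then show ?thesis by (simp add: util_def slot_def fun_eq_iff)
    qed
    then have Leq: "L \<tau> (util (?h g)) = L \<tau> (util f)" for g
      using L unfolding learner_def by blast
    let ?c = "\<lambda>x z v. 1 + x (pos t i (snd (snd z)) * K + v) :: real"
    \<comment> \<open>Markov's inequality for \<open>2\<close> to the number of agreeing letters, where \<open>2 powr x k = 1 + x k\<close>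
      because \<open>x k\<close> is 0 or 1.\<close>
    have tail: "of_bool (\<gamma> < agreement (?h g) t i x) \<le>
        (\<Prod>z\<in>B. ?c x z (g z)) / 2 powr (\<gamma> * real m)"
      if x: "x \<in> ?S" for x g
    proof -
      have sl: "slot (?h g) t i r = pos t i r * K + g (i, ?q, r)" if "r < m" for r
        using that by (simp add: slot_def B_def)
      have "(\<Prod>z\<in>B. ?c x z (g z)) = (\<Prod>r<m. 1 + x (slot (?h g) t i r))"
        using inj sl by (simp add: prod.reindex B_def[symmetric]) (simp add: B_def prod.reindex)
      also have "\<dots> = (\<Prod>r<m. 2 powr x (slot (?h g) t i r))"
      proof (intro prod.cong refl)
        fix r
        show "1 + x (slot (?h g) t i r) = 2 powr x (slot (?h g) t i r)"
          using strategy_in_01[OF x, of "slot (?h g) t i r"] by auto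
      qed
      also have "\<dots> = 2 powr (real m * agreement (?h g) t i x)"
        using m_pos by (simp add: agreement_def powr_sum)
      finally have eq: "(\<Prod>z\<in>B. ?c x z (g z)) = 2 powr (real m * agreement (?h g) t i x)" .
      have "2 powr (\<gamma> * real m) \<le> 2 powr (real m * agreement (?h g) t i x)"
        if "\<gamma> < agreement (?h g) t i x"
        using that m_pos by (intro powr_mono) (auto simp: mult.commute)
      then show ?thesis unfolding eq by (simp add: of_bool_def)
    qed
    have fin: "finite (set_pmf (?P B))"
      using B(2) by (intro finite_set_Pi_pmf) (auto simp: set_pmf_of_set_K)
    note int = integrable_measure_pmf_finite[OF fin]
    \<comment> \<open>Exactly one of the \<open>K\<close> letters matches the action of
      \<open>x\<close>, so the factor is 2 with probability \<open>1 / K\<close> and 1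
      otherwise.\<close>
    have single: "measure_pmf.expectation (pmf_of_set {..<K}) (?c x z) = 1 + 1 / real K"
      if x: "x \<in> ?S" and z: "z \<in> B" for x z
    proof -
      have p: "pos t i (snd (snd z)) < M"
        using z iD by (auto simp: B_def intro: pos_less)
      obtain a where a: "x = grid_strategy M K a" "\<forall>p<M. a p < K"
        using x by (auto simp: strategy_set_grid_game)
      have "(\<Sum>v<K. x (pos t i (snd (snd z)) * K + v)) =
          (\<Sum>v<K. if v = a (pos t i (snd (snd z))) then 1 else 0)"
        unfolding a(1) using p by (intro sum.cong refl) (auto simp: grid_strategy_index)
      also have "\<dots> = 1" using a(2) p by simp
      finally show ?thesis
        using K_pos by (subst integral_pmf_of_set) (auto simp: sum.distrib add_divide_distrib)
    qed
    have mean: "measure_pmf.expectation (?P B) (\<lambda>g. \<Prod>z\<in>B. ?c x z (g z)) = (1 + 1 / real K) ^ m"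
      if x: "x \<in> ?S" for x
    proof -
      have "measure_pmf.expectation (?P B) (\<lambda>g. \<Prod>z\<in>B. ?c x z (g z)) =
          (\<Prod>z\<in>B. measure_pmf.expectation (pmf_of_set {..<K}) (?c x z))"
        using B(2) strategy_ge_0[OF x]
        by (intro expectation_prod_Pi_pmf integrable_measure_pmf_finite)
           (auto simp: set_pmf_of_set_K add_nonneg_nonneg)
      also have "\<dots> = (\<Prod>z\<in>B. 1 + 1 / real K)"
        using x by (intro prod.cong single) auto
      also have "\<dots> = (1 + 1 / real K) ^ m"
        using inj by (simp add: B_def card_image)
      finally show ?thesis .
    qed
    have "measure_pmf.expectation (?P B) (\<lambda>g. \<Sum>x\<in>?S.
          pmf (L \<tau> (util (?h g))) x * of_bool (\<gamma> < agreement (?h g) t i x)) \<le>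
        measure_pmf.expectation (?P B) (\<lambda>g. \<Sum>x\<in>?S.
          ?w x * ((\<Prod>z\<in>B. ?c x z (g z)) / 2 powr (\<gamma> * real m)))"
      unfolding Leq by (intro integral_mono int sum_mono mult_left_mono tail) auto
    also have "\<dots> = (\<Sum>x\<in>?S. ?w x * ((1 + 1 / real K) ^ m / 2 powr (\<gamma> * real m)))"
      by (subst Bochner_Integration.integral_sum) (auto intro!: int sum.cong simp: mean)
    also have "\<dots> = (\<Sum>x\<in>?S. ?w x) * ((1 + 1 / real K) ^ m / 2 powr (\<gamma> * real m))"
      by (rule sum_distrib_right[symmetric])
    \<comment> \<open>The learner's weights sum to 1, so the number of strategies does not enter the
      bound.\<close>
    also have "(\<Sum>x\<in>?S. ?w x) = 1"
      using L finite_strategy_set_grid_game by (intro sum_pmf_eq_1) (auto simp: learner_def)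
    finally show "measure_pmf.expectation (?P B) (\<lambda>g. \<Sum>x\<in>?S.
          pmf (L \<tau> (util (?h g))) x * of_bool (\<gamma> < agreement (?h g) t i x)) \<le>
        (1 + 1 / real K) ^ m / 2 powr (\<gamma> * real m)" by simp
  qed
qed

section \<open>Regret for fixed noise\<close>

text \<open>The weight on strategies that agree too well with words not yet revealed to the learner.\<close>

definition lucky :: "(nat \<Rightarrow> (nat \<Rightarrow> nat \<Rightarrow> real) \<Rightarrow> (nat \<Rightarrow> real) pmf) \<Rightarrow> real \<Rightarrow>
    (nat \<times> nat \<times> nat \<Rightarrow> nat) \<Rightarrow> real" where
  "lucky L \<gamma> \<omega> = (\<Sum>t<T. \<Sum>s<T. \<Sum>i\<in>fresh s t. \<Sum>x\<in>strategy_set G.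
     pmf (L s (util \<omega>)) x * of_bool (\<gamma> < agreement \<omega> t i x))"

text \<open>Utilities lie between 0 and 1, so every swap has value at most 1; hence the supremum
  defining the regret is over a bounded set and dominates each swap.\<close>

lemma swap_value_le_regret:
  assumes L: "learner G L" and \<omega>: "\<And>z. \<omega> z < K"
    and \<phi>: "\<phi> \<in> strategy_set G \<rightarrow> strategy_set G"
  shows "(\<Sum>t<T. \<Sum>x\<in>strategy_set G. (inner_d (dim G) (util \<omega> t) (\<phi> x)
      - inner_d (dim G) (util \<omega> t) x) * pmf (L t (util \<omega>)) x) / real T
    \<le> swap_regret G T L (util \<omega>)"
proof -
  let ?S = "strategy_set G"
  let ?V = "\<lambda>\<phi>. (1 / real T) * (\<Sum>s<T. measure_pmf.expectation (L s (util \<omega>))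
      (\<lambda>x. inner_d (dim G) (util \<omega> s) (\<phi> x) - inner_d (dim G) (util \<omega> s) x))"
  have LS: "set_pmf (L s u) \<subseteq> ?S" for s u using L by (simp add: learner_def)
  have expect: "measure_pmf.expectation (L s (util \<omega>)) F = (\<Sum>x\<in>?S. F x * pmf (L s (util \<omega>)) x)"
    for s and F :: "(nat \<Rightarrow> real) \<Rightarrow> real"
    using LS finite_strategy_set_grid_game by (intro integral_measure_pmf_real) auto
  have "?V \<psi> \<le> 1" if "\<psi> \<in> ?S \<rightarrow> ?S" for \<psi>
  proof -
    have "measure_pmf.expectation (L s (util \<omega>))
      (\<lambda>x. inner_d (dim G) (util \<omega> s) (\<psi> x) - inner_d (dim G) (util \<omega> s) x) \<le> 1" for s
    proof (rule expectation_le_const)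
      show "finite (set_pmf (L s (util \<omega>)))"
        using LS finite_strategy_set_grid_game by (rule finite_subset)
      fix x assume "x \<in> set_pmf (L s (util \<omega>))"
      then have x: "x \<in> ?S" "\<psi> x \<in> ?S" using LS that by auto
      show "inner_d (dim G) (util \<omega> s) (\<psi> x) - inner_d (dim G) (util \<omega> s) x \<le> 1"
        using inner_util_bounds(1)[of \<omega> x s, OF \<omega> x(1)]
          inner_util_bounds(2)[of \<omega> "\<psi> x" s, OF \<omega> x(2)]
        by linarith
    qed
    then have "(\<Sum>s<T. measure_pmf.expectation (L s (util \<omega>))
      (\<lambda>x. inner_d (dim G) (util \<omega> s) (\<psi> x) - inner_d (dim G) (util \<omega> s) x)) \<le> (\<Sum>s<T. 1)"
      by (intro sum_mono) auto
    then show ?thesis using T_pos by simp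
  qed
  then have "bdd_above (?V ` (?S \<rightarrow> ?S))" by (intro bdd_aboveI2)
  then have "?V \<phi> \<le> swap_regret G T L (util \<omega>)"
    unfolding swap_regret_def using \<phi> by (intro cSUP_upper)
  then show ?thesis by (simp add: expect)
qed

text \<open>The main term allows agreement \<open>\<gamma>\<close> at every fresh height. The second
  term pays for the light rounds before \<open>\<tau> x\<close>, and the third for agreement above
  \<open>\<gamma>\<close>.\<close>

lemma swap_regret_ge:
  assumes L: "learner G L" and \<omega>: "\<And>z. \<omega> z < K"
    and \<gamma>: "0 \<le> \<gamma>" and \<delta>: "0 < \<delta>" "\<delta> \<le> 1"
  shows "(1 - real D * \<gamma>) / real D - 2 * \<delta> * real T - lucky L \<gamma> \<omega> / (\<delta> * real T)
    \<le> swap_regret G T L (util \<omega>)"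
proof -
  let ?S = "strategy_set G" and ?g = "(1 - real D * \<gamma>) / real D"
  define w where "w t x = pmf (L t (util \<omega>)) x" for t x
  define U where "U t x = inner_d (dim G) (util \<omega> t) x" for t x
  define hit where "hit t i x = (of_bool (\<gamma> < agreement \<omega> t i x) :: real)" for t i x
  \<comment> \<open>Comparison with all rounds replaces the maximal weight; a strategy that is never
    played gets \<open>\<tau> x = 0\<close>.\<close>
  define \<tau> where "\<tau> x = (LEAST s. s < T \<and> (\<forall>t<T. \<delta> * w t x \<le> w s x))" for x
  define \<phi> where "\<phi> x = target \<omega> (\<tau> x)" for x
  have w0: "0 \<le> w t x" for t x by (simp add: w_def)
  have wsum: "(\<Sum>x\<in>?S. w t x) = 1" for t
    unfolding w_def using L finite_strategy_set_grid_game
    by (intro sum_pmf_eq_1) (auto simp: learner_def)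
  have "\<exists>s. s < T \<and> (\<forall>t<T. \<delta> * w t x \<le> w s x)" for x
  proof -
    have "Max ((\<lambda>t. w t x) ` {..<T}) \<in> (\<lambda>t. w t x) ` {..<T}"
      using T_pos by (intro Max_in) auto
    then obtain s where s: "s < T" "w s x = Max ((\<lambda>t. w t x) ` {..<T})" by auto
    have "\<delta> * w t x \<le> w s x" if "t < T" for t
    proof -
      have "\<delta> * w t x \<le> w t x" using \<delta> w0[of t x] by (simp add: mult_left_le_one_le)
      also have "\<dots> \<le> w s x" unfolding s(2) using that by (intro Max_ge) auto
      finally show ?thesis .
    qed
    then show ?thesis using s(1) by blast
  qed
  then have \<tau>: "\<tau> x < T" "\<And>t. t < T \<Longrightarrow> \<delta> * w t x \<le> w (\<tau> x) x" for x
    using LeastI_ex[of "\<lambda>s. s < T \<and> (\<forall>t<T. \<delta> * w t x \<le> w s x)"] unfolding \<tau>_def by blast+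
  have less_\<tau>: "\<exists>t'<T. w t x < \<delta> * w t' x" if "t < \<tau> x" for t x
    using not_less_Least[OF that[unfolded \<tau>_def]] \<tau>(1)[of x] that by (auto simp: not_le)
  have g1: "?g \<le> 1"
  proof -
    have "0 \<le> real D * \<gamma>" using \<gamma> by simp
    then have "1 - real D * \<gamma> \<le> real D" using D_pos by linarith
    then show ?thesis using D_pos by simp
  qed
  have U_bounds: "0 \<le> U t x" "U t x \<le> 1" if "x \<in> ?S" for t x
    unfolding U_def using inner_util_bounds[of \<omega> x t, OF \<omega> that] by auto
  have \<phi>S: "\<phi> x \<in> ?S" for x unfolding \<phi>_def using \<omega> by (rule target_in)
  have hit0: "0 \<le> (\<Sum>i\<in>fresh s t. w s x * hit t i x)" for s t x
    by (intro sum_nonneg mult_nonneg_nonneg w0) (simp add: hit_def)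
  have step: "?g * w t x - 2 * \<delta> * (\<Sum>s<T. w s x) - (\<Sum>s<T. \<Sum>i\<in>fresh s t. w s x * hit t i x) / \<delta>
      \<le> (U t (\<phi> x) - U t x) * w t x" if x: "x \<in> ?S" and t: "t < T" for x t
  proof (cases "\<tau> x \<le> t")
    case True
    have fD: "finite (fresh (\<tau> x) t)" "card (fresh (\<tau> x) t) \<le> D"
    proof -
      have "fresh (\<tau> x) t \<subseteq> {..<D}" by (auto simp: fresh_def)
      then show "finite (fresh (\<tau> x) t)" "card (fresh (\<tau> x) t) \<le> D"
        using finite_subset card_mono[of "{..<D}"] by auto
    qed
    let ?H = "\<Sum>i\<in>fresh (\<tau> x) t. hit t i x"
    have H0: "0 \<le> ?H" by (intro sum_nonneg) (simp add: hit_def)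
    have "(\<Sum>i\<in>fresh (\<tau> x) t. agreement \<omega> t i x) \<le> (\<Sum>i\<in>fresh (\<tau> x) t. \<gamma> + hit t i x)"
    proof (rule sum_mono)
      fix i show "agreement \<omega> t i x \<le> \<gamma> + hit t i x"
        using agreement_bounds[OF x, of \<omega> t i] \<gamma> by (auto simp: hit_def of_bool_def)
    qed
    also have "\<dots> = real (card (fresh (\<tau> x) t)) * \<gamma> + ?H" by (simp add: sum.distrib)
    also have "\<dots> \<le> real D * \<gamma> + ?H" using fD \<gamma> by (intro add_right_mono mult_right_mono) auto
    finally have le: "(\<Sum>i\<in>fresh (\<tau> x) t. agreement \<omega> t i x) \<le> real D * \<gamma> + ?H" .
    have "?g - ?H \<le> (1 - (real D * \<gamma> + ?H)) / real D"
    proof -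
      have "?H / real D \<le> ?H" using H0 D_pos mult_left_mono[of 1 "real D" ?H] by (simp add: divide_le_eq)
      then show ?thesis by (simp add: diff_divide_distrib add_divide_distrib)
    qed
    also have "\<dots> \<le> (1 - (\<Sum>i\<in>fresh (\<tau> x) t. agreement \<omega> t i x)) / real D"
      using le D_pos by (intro divide_right_mono) auto
    also have "\<dots> \<le> U t (\<phi> x) - U t x"
      unfolding U_def \<phi>_def using \<omega> True t x by (rule target_gain)
    finally have "(?g - ?H) * w t x \<le> (U t (\<phi> x) - U t x) * w t x"
      using w0 by (intro mult_right_mono)
    \<comment> \<open>Freshness concerns the choice in round \<open>\<tau> x\<close>, so the weight
      in round \<open>t\<close> is traded for the one there, at the price
      \<open>1 / \<delta>\<close>.\<close>
    moreover have "?H * w t x \<le> (\<Sum>s<T. \<Sum>i\<in>fresh s t. w s x * hit t i x) / \<delta>"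
    proof -
      have "\<delta> * w t x * ?H \<le> w (\<tau> x) x * ?H"
        using \<tau>(2)[OF t] H0 by (intro mult_right_mono)
      also have "\<dots> = (\<Sum>i\<in>fresh (\<tau> x) t. w (\<tau> x) x * hit t i x)" by (simp add: sum_distrib_left)
      also have "\<dots> \<le> (\<Sum>s<T. \<Sum>i\<in>fresh s t. w s x * hit t i x)"
        using \<tau>(1) hit0 by (intro member_le_sum) auto
      finally show ?thesis using \<delta> by (simp add: le_divide_eq mult_ac)
    qed
    moreover have "0 \<le> 2 * \<delta> * (\<Sum>s<T. w s x)"
      using \<delta> w0 by (intro mult_nonneg_nonneg sum_nonneg) auto
    ultimately show ?thesis by (simp add: left_diff_distrib)
  next
    case False
    then obtain t' where t': "t' < T" "w t x < \<delta> * w t' x" using less_\<tau>[of t x] by auto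
    have "w t' x \<le> (\<Sum>s<T. w s x)" using t' w0 by (intro member_le_sum) auto
    then have "w t x \<le> \<delta> * (\<Sum>s<T. w s x)"
      using t'(2) \<delta> by (meson less_imp_le mult_left_mono order_trans)
    \<comment> \<open>A swap loses at most 1 in any round and \<open>?g \<le> 1\<close>, so the gain
      is at least \<open>?g - 2\<close>.\<close>
    moreover have "(?g - 2) * w t x \<le> (U t (\<phi> x) - U t x) * w t x"
      using U_bounds[OF x, of t] U_bounds[OF \<phi>S, of t x] g1 w0 by (intro mult_right_mono) auto
    moreover have "0 \<le> (\<Sum>s<T. \<Sum>i\<in>fresh s t. w s x * hit t i x) / \<delta>"
      using \<delta> sum_nonneg[of "{..<T}" "\<lambda>s. \<Sum>i\<in>fresh s t. w s x * hit t i x"] hit0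
      by simp
    ultimately show ?thesis by (simp add: left_diff_distrib)
  qed
  have "(\<Sum>t<T. \<Sum>x\<in>?S. ?g * w t x - 2 * \<delta> * (\<Sum>s<T. w s x)
        - (\<Sum>s<T. \<Sum>i\<in>fresh s t. w s x * hit t i x) / \<delta>)
      \<le> (\<Sum>t<T. \<Sum>x\<in>?S. (U t (\<phi> x) - U t x) * w t x)"
    using step by (intro sum_mono) auto
  also have "(\<Sum>t<T. \<Sum>x\<in>?S. ?g * w t x - 2 * \<delta> * (\<Sum>s<T. w s x)
        - (\<Sum>s<T. \<Sum>i\<in>fresh s t. w s x * hit t i x) / \<delta>)
      = ?g * real T - 2 * \<delta> * (real T * real T) - lucky L \<gamma> \<omega> / \<delta>"
  proof -
    have "(\<Sum>x\<in>?S. \<Sum>s<T. w s x) = real T"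
      by (subst sum.swap) (simp add: wsum)
    moreover have "(\<Sum>t<T. \<Sum>x\<in>?S. \<Sum>s<T. \<Sum>i\<in>fresh s t. w s x * hit t i x) = lucky L \<gamma> \<omega>"
      unfolding lucky_def w_def hit_def
      by (rule sum.cong[OF refl], subst sum.swap, rule sum.cong[OF refl], rule sum.swap)
    ultimately show ?thesis
      by (simp add: sum_subtractf wsum flip: sum_distrib_left sum_divide_distrib)
        (simp add: algebra_simps)
  qed
  finally have "(?g * real T - 2 * \<delta> * (real T * real T) - lucky L \<gamma> \<omega> / \<delta>) / real T \<le>
      (\<Sum>t<T. \<Sum>x\<in>?S. (U t (\<phi> x) - U t x) * w t x) / real T"
    by (intro divide_right_mono) auto
  also have "\<dots> \<le> swap_regret G T L (util \<omega>)"
    unfolding U_def w_def using L \<omega> \<phi>S by (intro swap_value_le_regret) auto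
  finally show ?thesis
    using T_pos by (simp add: diff_divide_distrib)
qed

section \<open>Averaging over the noise\<close>

lemma expectation_lucky:
  assumes L: "learner G L"
  shows "measure_pmf.expectation noise (lucky L \<gamma>) \<le>
    (real T)\<^sup>2 * real D * ((1 + 1 / real K) ^ m / 2 powr (\<gamma> * real m))"
proof -
  let ?\<beta> = "(1 + 1 / real K) ^ m / 2 powr (\<gamma> * real m)"
  note int = integrable_measure_pmf_finite[OF finite_noise]
  have "measure_pmf.expectation noise (lucky L \<gamma>) =
      (\<Sum>t<T. \<Sum>s<T. \<Sum>i\<in>fresh s t. measure_pmf.expectation noise (\<lambda>\<omega>. \<Sum>x\<in>strategy_set G.
        pmf (L s (util \<omega>)) x * of_bool (\<gamma> < agreement \<omega> t i x)))"
    unfolding lucky_def by (subst Bochner_Integration.integral_sum, rule int)+ simp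
  also have "\<dots> \<le> (\<Sum>t<T. \<Sum>s<T. \<Sum>i\<in>fresh s t. ?\<beta>)"
    using L by (intro sum_mono agreement_tail) auto
  also have "\<dots> \<le> (\<Sum>t<T. \<Sum>s<T. real D * ?\<beta>)"
  proof (intro sum_mono)
    fix s t
    have "card (fresh s t) \<le> card {..<D}"
      by (intro card_mono) (auto simp: fresh_def)
    then show "(\<Sum>i\<in>fresh s t. ?\<beta>) \<le> real D * ?\<beta>"
      by (simp add: mult_right_mono divide_right_mono)
  qed
  also have "\<dots> = (real T)\<^sup>2 * real D * ?\<beta>"
    by (simp add: power2_eq_square)
  finally show ?thesis .
qed

lemma adversary_noise: "adversary G T (map_pmf util noise)"
proof -
  have "\<bar>inner_d (dim G) (util \<omega> t) x\<bar> \<le> 1"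
    if "\<omega> \<in> set_pmf noise" "x \<in> strategy_set G" for \<omega> t x
    using inner_util_bounds[of \<omega> x t] noise_less that by simp
  then show ?thesis by (auto simp: adversary_def)
qed

lemma expected_swap_regret_ge:
  assumes L: "learner G L" and \<gamma>: "0 \<le> \<gamma>" and \<delta>: "0 < \<delta>" "\<delta> \<le> 1"
  shows "(1 - real D * \<gamma>) / real D - 2 * \<delta> * real T
      - real T * real D * ((1 + 1 / real K) ^ m / 2 powr (\<gamma> * real m)) / \<delta>
    \<le> expected_swap_regret G T (map_pmf util noise) L"
proof -
  let ?c = "(1 - real D * \<gamma>) / real D - 2 * \<delta> * real T"
    and ?\<beta> = "(1 + 1 / real K) ^ m / 2 powr (\<gamma> * real m)"
  note int = integrable_measure_pmf_finite[OF finite_noise]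
  have "?c - real T * real D * ?\<beta> / \<delta> = ?c - (real T)\<^sup>2 * real D * ?\<beta> / (\<delta> * real T)"
    using T_pos by (simp add: power2_eq_square)
  also have "\<dots> \<le> ?c - measure_pmf.expectation noise (lucky L \<gamma>) / (\<delta> * real T)"
    using expectation_lucky[OF L, of \<gamma>] \<delta> by (intro diff_left_mono divide_right_mono) auto
  also have "\<dots> = measure_pmf.expectation noise (\<lambda>\<omega>. ?c - lucky L \<gamma> \<omega> / (\<delta> * real T))"
    by (subst Bochner_Integration.integral_diff) (auto intro: int)
  also have "\<dots> \<le> measure_pmf.expectation noise (\<lambda>\<omega>. swap_regret G T L (util \<omega>))"
    using L \<gamma> \<delta> noise_less by (intro integral_mono_AE int AE_pmfI swap_regret_ge)
  also have "\<dots> = expected_swap_regret G T (map_pmf util noise) L"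
    by (simp add: expected_swap_regret_def)
  finally show ?thesis .
qed

end

section \<open>Choice of parameters\<close>

text \<open>Since \<open>1 + 1 / K\<close> to the power \<open>K = 8 * n\<close> is at most 4, the
  numerator is at most \<open>2 ^ (14 * n)\<close>; the exponent in the denominator is
  \<open>28 * n\<close>, twice as large.\<close>

lemma tail_estimate:
  assumes n: "2 \<le> n"
  shows "(1 + 1 / real (8 * n)) ^ (8 * n * (7 * n)) / 2 powr (1 / (2 * real n) * real (8 * n * (7 * n)))
    \<le> 1 / 2 ^ (14 * n)"
proof -
  have "(1 + 1 / real (8 * n)) ^ (8 * n) \<le> exp (1 / real (8 * n)) ^ (8 * n)"
    by (intro power_mono) (auto intro: exp_ge_add_one_self)
  also have "\<dots> = exp 1" using n by (simp flip: exp_of_nat_mult)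
  also have "\<dots> \<le> 4" using exp_le by simp
  finally have "((1 + 1 / real (8 * n)) ^ (8 * n)) ^ (7 * n) \<le> 4 ^ (7 * n)"
    by (intro power_mono) auto
  also have "(4::real) ^ (7 * n) = 2 ^ (14 * n)"
    using power_mult[of "2::real" 2 "7 * n"] by simp
  finally have a: "(1 + 1 / real (8 * n)) ^ (8 * n * (7 * n)) \<le> 2 ^ (14 * n)"
    by (simp only: power_mult)
  have "1 / (2 * real n) * real (8 * n * (7 * n)) = real (28 * n)"
    using n by (simp add: field_simps)
  then have "2 powr (1 / (2 * real n) * real (8 * n * (7 * n))) = 2 ^ (28 * n)"
    by (simp only: powr_realpow)
  also have "\<dots> = (2::real) ^ (14 * n) * 2 ^ (14 * n)"
    by (simp flip: power_add)
  finally show ?thesis using a by (simp add: divide_le_eq)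
qed

text \<open>For \<open>\<delta> = 1 / (16 * D * T)\<close> the lucky term is
  \<open>16 * D ^ 2 * T ^ 2\<close> times the tail bound; this factor appears when it is required to
  be at most \<open>1 / (8 * D)\<close>.\<close>

lemma polynomial_factor_estimate:
  assumes "2 \<le> n" "D \<le> n" "T \<le> 2 ^ D"
  shows "128 * real D ^ 3 * (real T)\<^sup>2 \<le> 2 ^ (14 * n)"
proof -
  have "T \<le> 2 ^ n" using assms by (meson order_trans power_increasing one_le_numeral)
  then have T: "real T \<le> 2 ^ n" by (metis of_nat_le_iff of_nat_numeral of_nat_power)
  have "real D \<le> 2 ^ n" using assms(2) of_nat_less_two_power[of n, where 'a = real] by linarith
  then have "128 * real D ^ 3 * (real T)\<^sup>2 \<le> 2 ^ 7 * (2 ^ n) ^ 3 * (2 ^ n)\<^sup>2"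
    using T by (intro mult_mono power_mono) auto
  also have "\<dots> = 2 ^ (7 + n * 3 + n * 2)" by (simp only: power_add power_mult)
  also have "\<dots> \<le> 2 ^ (14 * n)" using assms(1) by (intro power_increasing) auto
  finally show ?thesis .
qed

lemma grid_game_swap_regret:
  assumes n: "2 \<le> n" and D: "0 < D" "D \<le> n" and T: "0 < T" "T \<le> 2 ^ D"
  shows "\<exists>A. adversary (grid_game (2 * n * (8 * n * (7 * n))) (8 * n)) T A \<and>
    (\<forall>L. learner (grid_game (2 * n * (8 * n * (7 * n))) (8 * n)) L \<longrightarrow>
      1 / (4 * real D) \<le>
        expected_swap_regret (grid_game (2 * n * (8 * n * (7 * n))) (8 * n)) T A L)"
proof -
  interpret swap_adversary n D T "8 * n * (7 * n)" "8 * n"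
    using assms by unfold_locales auto
  \<comment> \<open>The choice of \<open>?\<gamma>\<close> makes \<open>D * ?\<gamma>\<close> at
    most 1/2 and leaves a main term \<open>1 / (2 * D)\<close>; with \<open>?\<delta>\<close> the
    light rounds cost \<open>1 / (8 * D)\<close>, and the lucky term may cost as much again.\<close>
  let ?\<gamma> = "1 / (2 * real n)" and ?\<delta> = "1 / (16 * real D * real T)"
  let ?\<beta> = "(1 + 1 / real (8 * n)) ^ (8 * n * (7 * n)) / 2 powr (?\<gamma> * real (8 * n * (7 * n)))"
  have "1 / (4 * real D) \<le> expected_swap_regret G T (map_pmf util noise) L" if L: "learner G L" for L
  proof -
    have "real D * ?\<gamma> \<le> 1 / 2" using D n by (simp add: field_simps)
    then have "1 / (2 * real D) \<le> (1 - real D * ?\<gamma>) / real D"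
      using D by (simp add: field_simps)
    moreover have "2 * ?\<delta> * real T = 1 / (8 * real D)"
      using D T by (simp add: field_simps)
    moreover have "real T * real D * ?\<beta> / ?\<delta> \<le> 1 / (8 * real D)"
    proof -
      have "128 * real D ^ 3 * (real T)\<^sup>2 * ?\<beta> \<le> 2 ^ (14 * n) * (1 / 2 ^ (14 * n))"
        using polynomial_factor_estimate[OF n D(2) T(2)] tail_estimate[OF n]
        by (intro mult_mono) auto
      then have "128 * real D ^ 3 * (real T)\<^sup>2 * ?\<beta> \<le> 1" by simp
      moreover have "real T * real D * b / ?\<delta> = 128 * real D ^ 3 * (real T)\<^sup>2 * b / (8 * real D)" for b
        using D by (simp add: power2_eq_square power3_eq_cube)
      ultimately show ?thesis using D by (simp only:) (intro divide_right_mono, auto)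
    qed
    moreover have "1 / (4 * real D) = 1 / (2 * real D) - 1 / (8 * real D) - 1 / (8 * real D)"
      using D by (simp add: field_simps)
    moreover have "?\<delta> \<le> 1"
    proof -
      have "1 * 1 \<le> real D * real T" using D T by (intro mult_mono) auto
      then show ?thesis by (simp add: divide_le_eq)
    qed
    ultimately show ?thesis
      using expected_swap_regret_ge[OF L, of ?\<gamma> ?\<delta>] D T by simp
  qed
  then show ?thesis using adversary_noise by blast
qed

theorem theorem4p5:
  shows "\<exists>c>0. \<forall>D::nat. \<exists>t. wf_tdp t \<and> D \<le> dim t \<and>
     (\<forall>(\<epsilon>::real) (T::nat). 0 < \<epsilon> \<longrightarrow> \<epsilon> \<le> c \<longrightarrow> 1 \<le> T \<longrightarrow>
        real T \<le> exp (c * min (real (dim t) powr (1/14)) (\<epsilon> powr (-1/6))) \<longrightarrow>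
        (\<exists>A. adversary t T A \<and>
             (\<forall>L. learner t L \<longrightarrow> expected_swap_regret t T A L \<ge> \<epsilon>)))"
proof (intro exI[of _ "1/16"] conjI allI)
  fix D\<^sub>0 :: nat
  define n where "n = max 2 D\<^sub>0"
  define t where "t = grid_game (2 * n * (8 * n * (7 * n))) (8 * n)"
  have n: "2 \<le> n" "D\<^sub>0 \<le> n" by (auto simp: n_def)
  have dim: "dim t = 896 * n ^ 4"
    by (simp add: t_def dim_grid_game power4_eq_xxxx)
  have "n ^ 1 \<le> n ^ 4" using n by (intro power_increasing) auto
  then have "n \<le> dim t" using dim by simp
  \<comment> \<open>As \<open>n \<ge> 2\<close>, the constant 896 in the dimension is absorbed by
    \<open>n ^ 10\<close>, which together with \<open>n ^ 4\<close> gives the exponent 14.\<close>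
  have dim_root: "real (dim t) powr (1/14) \<le> real n"
  proof -
    have "(896::nat) \<le> 2 ^ 10" by simp
    also have "(2::nat) ^ 10 \<le> n ^ 10" using n by (intro power_mono) auto
    finally have "dim t \<le> n ^ 10 * n ^ 4" unfolding dim by (intro mult_right_mono) auto
    then have "dim t \<le> n ^ 14" by (simp flip: power_add)
    then have "real (dim t) \<le> real n ^ 14" by (metis of_nat_le_iff of_nat_power)
    then have "real (dim t) powr (1/14) \<le> (real n powr 14) powr (1/14)"
      using n by (intro powr_mono2) (auto simp: powr_numeral)
    also have "\<dots> = real n" using n by (simp only: powr_powr) simp
    finally show ?thesis .
  qed
  have force_regret: "\<exists>A. adversary t T A \<and> (\<forall>L. learner t L \<longrightarrow> expected_swap_regret t T A L \<ge> \<epsilon>)"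
    if \<epsilon>: "0 < \<epsilon>" "\<epsilon> \<le> 1/16" and T: "1 \<le> T"
      and le: "real T \<le> exp (1/16 * min (real (dim t) powr (1/14)) (\<epsilon> powr (-1/6)))" for \<epsilon> T
  proof -
    define y where "y = min (real (dim t) powr (1/14)) (\<epsilon> powr (-1/6))"
    \<comment> \<open>Depth \<open>y / 8\<close> suffices for the horizon because
      \<open>ln 2\<close> exceeds 1/2; the added 1 makes \<open>0 < D\<close> immediate.\<close>
    define D where "D = nat \<lceil>y / 8\<rceil> + 1"
    have y: "0 \<le> y" "y \<le> real n" "y \<le> \<epsilon> powr (-1/6)"
      using dim_root by (auto simp: y_def)
    have D_bounds: "y / 8 \<le> real D" "real D \<le> y / 8 + 2"
      using y(1) by (auto simp: D_def) linarith+
    have "exp (1/16 * y) \<le> exp (real D * ln 2)"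
    proof -
      have "y / 8 * (1/2) \<le> real D * ln 2"
        using D_bounds y(1) ln2_ge_two_thirds by (intro mult_mono) auto
      then show ?thesis by simp
    qed
    also have "\<dots> = 2 ^ D" by (simp add: exp_of_nat_mult)
    finally have "real T \<le> 2 ^ D" using le unfolding y_def[symmetric] by linarith
    then have "T \<le> 2 ^ D" by (metis of_nat_le_iff of_nat_numeral of_nat_power)
    moreover have "D \<le> n"
      using y D_bounds n by linarith
    ultimately obtain A where A: "adversary t T A"
        "\<And>L. learner t L \<Longrightarrow> 1 / (4 * real D) \<le> expected_swap_regret t T A L"
      using grid_game_swap_regret[of n D T] n T unfolding t_def D_def by auto
    \<comment> \<open>The weaker exponent -1 is enough here: \<open>\<epsilon> * y \<le> 1\<close>
      and \<open>\<epsilon> \<le> 1/16\<close> bound \<open>\<epsilon> * D\<close> by 1/8 +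
      1/8.\<close>
    have "\<epsilon> \<le> 1 / (4 * real D)"
    proof -
      have "y \<le> \<epsilon> powr (-1)"
        using y(3) powr_mono'[of "-1" "-1/6" \<epsilon>] \<epsilon> by simp
      then have "\<epsilon> * y \<le> 1"
        using \<epsilon> by (simp add: powr_minus_divide field_simps)
      moreover have "\<epsilon> * real D \<le> \<epsilon> * (y / 8 + 2)"
        using D_bounds \<epsilon> by (intro mult_left_mono) auto
      ultimately have "\<epsilon> * real D \<le> 1/4"
        using \<epsilon> by (simp add: algebra_simps)
      then show ?thesis by (simp add: D_def field_simps)
    qed
    then show ?thesis using A by (meson order_trans)
  qed
  show "\<exists>t. wf_tdp t \<and> D\<^sub>0 \<le> dim t \<and>
     (\<forall>(\<epsilon>::real) (T::nat). 0 < \<epsilon> \<longrightarrow> \<epsilon> \<le> 1/16 \<longrightarrow> 1 \<le> T \<longrightarrow>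
        real T \<le> exp (1/16 * min (real (dim t) powr (1/14)) (\<epsilon> powr (-1/6))) \<longrightarrow>
        (\<exists>A. adversary t T A \<and>
             (\<forall>L. learner t L \<longrightarrow> expected_swap_regret t T A L \<ge> \<epsilon>)))"
  proof (intro exI[of _ t] conjI allI impI)
    show "wf_tdp t" unfolding t_def using n by (intro wf_grid_game) auto
    show "D\<^sub>0 \<le> dim t" using n(2) \<open>n \<le> dim t\<close> by (rule order_trans)
  qed (rule force_regret)
qed simp

end
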